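(* Let $\mathcal{H}$ be a Hilbert space and $S\in\mathcal{B}(\mathcal{H})$. If $u,v\in\mathcal{H}$, then $S\in Q_{u\otimes v}$ if and only if $S=(I-P)SP$, where $P=P_{\mathcal{H}_1}$ is the orthogonal projection onto $\mathcal{H}_1$ and $\mathcal{H}_1$ is the one-dimensional space spanned by $v$.
   Context: $\mathcal{B}(\mathcal{H})$ denotes the bounded linear operators on $\mathcal{H}$. The operator $u\otimes v$ is defined by $(u\otimes v)(h)=\langle h,v\rangle u$ for $h\in\mathcal{H}$. For $T\in\mathcal{B}(\mathcal{H})$ with spectral radius $r(T)$ and $m\ge 1$, put $d_m=\frac{1}{1/m+r(T)}$ and $R_m=R_m(T)=\left(\sum_{n=0}^\infty d_m^{2n}T^{*n}T^n\right)^{1/2}$, a positive invertible operator. Define $Q_T=\{S\in\mathcal{B}(\mathcal{H}):\|R_mSR_m^{-1}\|\to 0 \text{ as } m\to\infty\}$.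
   Formalization: The formal statement assumes u ≠ 0; for u = 0, v ≠ 0 and dim H ≥ 2 the claim is false, since Q_0 = {0} while S = w⊗v with nonzero w orthogonal to v satisfies S = (I−P)SP. *)

theory Defs
  imports "HOL-Analysis.Analysis" "HOL-Library.Nonpos_Ints"
begin

text \<open>Complex Hilbert spaces. The inner product is linear in the first argument and
  conjugate-linear in the second. The real vector space structure, the norm and completeness
  are those of \<^class>\<open>banach\<close>.\<close>

class complex_hilbert = banach +
  fixes scaleC :: "complex \<Rightarrow> 'a \<Rightarrow> 'a"  (infixr \<open>*\<^sub>C\<close> 75)
    and cinner :: "'a \<Rightarrow> 'a \<Rightarrow> complex"
  assumes scaleC_add_right: "a *\<^sub>C (x + y) = a *\<^sub>C x + a *\<^sub>C y"
    and scaleC_add_left: "(a + b) *\<^sub>C x = a *\<^sub>C x + b *\<^sub>C x"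
    and scaleC_scaleC: "a *\<^sub>C (b *\<^sub>C x) = (a * b) *\<^sub>C x"
    and scaleC_one: "1 *\<^sub>C x = x"
    and scaleR_scaleC: "r *\<^sub>R x = complex_of_real r *\<^sub>C x"
    and cinner_add_left: "cinner (x + y) z = cinner x z + cinner y z"
    and cinner_scaleC_left: "cinner (a *\<^sub>C x) y = a * cinner x y"
    and cinner_commute: "cinner x y = cnj (cinner y x)"
    and cinner_self: "cinner x x = complex_of_real ((norm x)\<^sup>2)"

interpretation complex_vector: vector_space "scaleC :: complex \<Rightarrow> 'a \<Rightarrow> 'a::complex_hilbert"
  by unfold_locales
    (auto simp: scaleC_add_right scaleC_add_left scaleC_scaleC scaleC_one)

abbreviation cspan :: "'a::complex_hilbert set \<Rightarrow> 'a set"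
  where "cspan \<equiv> module.span scaleC"

lemma cinner_add_right:
  fixes x y z :: "'a::complex_hilbert"
  shows "cinner x (y + z) = cinner x y + cinner x z"
  by (metis cinner_commute cinner_add_left complex_cnj_add)

lemma cinner_scaleC_right:
  fixes x y :: "'a::complex_hilbert"
  shows "cinner x (a *\<^sub>C y) = cnj a * cinner x y"
  by (metis cinner_commute cinner_scaleC_left complex_cnj_mult)

lemma norm_scaleC:
  fixes x :: "'a::complex_hilbert"
  shows "norm (a *\<^sub>C x) = cmod a * norm x"
proof -
  have "complex_of_real ((norm (a *\<^sub>C x))\<^sup>2) = complex_of_real ((cmod a * norm x)\<^sup>2)"
    unfolding cinner_self[symmetric] cinner_scaleC_left cinner_scaleC_right
    by (simp add: cinner_self power_mult_distrib complex_norm_square del: of_real_power)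
  then show ?thesis
    by (simp add: power2_eq_iff_nonneg del: of_real_power)
qed

lemma cinner_Cauchy_Schwarz:
  fixes x y :: "'a::complex_hilbert"
  shows "cmod (cinner x y) \<le> norm x * norm y"
proof (cases "y = 0")
  case True
  have "cinner x y = 0"
    using cinner_add_right[of x 0 0] True by simp
  then show ?thesis by simp
next
  case False
  define c where "c = cinner x y / complex_of_real ((norm y)\<^sup>2)"
  define w where "w = x + (- c) *\<^sub>C y"
  have ny: "complex_of_real ((norm y)\<^sup>2) \<noteq> 0"
    using False by simp
  have wy: "cinner w y = 0"
    unfolding w_def cinner_add_left cinner_scaleC_left cinner_self c_def using ny
    by (simp del: of_real_power)
  have yw: "cinner y w = 0"
    using wy cinner_commute[of y w] by simp
  have x: "x = w + c *\<^sub>C y"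
    by (simp add: w_def)
  have "complex_of_real ((norm x)\<^sup>2) = cinner (w + c *\<^sub>C y) (w + c *\<^sub>C y)"
    using x cinner_self by metis
  also have "\<dots> = cinner w w + c * cnj c * cinner y y"
    by (simp add: cinner_add_left cinner_add_right cinner_scaleC_left cinner_scaleC_right wy yw)
  also have "\<dots> = complex_of_real ((norm w)\<^sup>2 + (cmod c * norm y)\<^sup>2)"
    by (simp add: cinner_self power_mult_distrib flip: complex_norm_square)
  finally have "(cmod c * norm y)\<^sup>2 \<le> (norm x)\<^sup>2"
    unfolding of_real_eq_iff by simp
  then have "cmod c * norm y \<le> norm x"
    by (rule power2_le_imp_le) simp
  moreover have "cmod c * norm y = cmod (cinner x y) / norm y"
    using False by (simp add: c_def norm_divide norm_power norm_mult power2_eq_square)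
  ultimately show ?thesis
    using False by (simp add: pos_divide_le_eq)
qed

text \<open>Elements of \<^typ>\<open>'a \<Rightarrow>\<^sub>L 'a\<close> need only be real-linear, so the algebra of bounded complex-linear
  operators is a subset. Its norm, series and composition are those of bounded linear functions.\<close>

definition bounded_ops :: "('a::complex_hilbert \<Rightarrow>\<^sub>L 'a) set"
  where "bounded_ops = {T :: 'a \<Rightarrow>\<^sub>L 'a. \<forall>c x. T (c *\<^sub>C x) = c *\<^sub>C T x}"

definition op_power :: "('a::complex_hilbert \<Rightarrow>\<^sub>L 'a) \<Rightarrow> nat \<Rightarrow> ('a \<Rightarrow>\<^sub>L 'a)"
  where "op_power T n = (((o\<^sub>L) T) ^^ n) id_blinfun"

definition op_adjoint :: "('a::complex_hilbert \<Rightarrow>\<^sub>L 'a) \<Rightarrow> ('a \<Rightarrow>\<^sub>L 'a)"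
  where "op_adjoint T =
    (THE S :: 'a \<Rightarrow>\<^sub>L 'a. S \<in> bounded_ops \<and> (\<forall>x y. cinner (T x) y = cinner x (S y)))"

definition op_inverse :: "('a::complex_hilbert \<Rightarrow>\<^sub>L 'a) \<Rightarrow> ('a \<Rightarrow>\<^sub>L 'a)"
  where "op_inverse T =
    (THE S :: 'a \<Rightarrow>\<^sub>L 'a. S \<in> bounded_ops \<and> S o\<^sub>L T = id_blinfun \<and> T o\<^sub>L S = id_blinfun)"

definition positive_op :: "('a::complex_hilbert \<Rightarrow>\<^sub>L 'a) \<Rightarrow> bool"
  where "positive_op T \<longleftrightarrow> T \<in> bounded_ops \<and> (\<forall>x. cinner (T x) x \<in> \<real>\<^sub>\<ge>\<^sub>0)"

definition op_sqrt :: "('a::complex_hilbert \<Rightarrow>\<^sub>L 'a) \<Rightarrow> ('a \<Rightarrow>\<^sub>L 'a)"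
  where "op_sqrt A = (THE R. positive_op R \<and> R o\<^sub>L R = A)"

text \<open>The operator \<open>R\<close> below is a two-sided inverse of \<open>T - \<mu>I\<close>.\<close>

definition op_spectrum :: "('a::complex_hilbert \<Rightarrow>\<^sub>L 'a) \<Rightarrow> complex set"
  where "op_spectrum T = {\<mu>. \<not> (\<exists>R :: 'a \<Rightarrow>\<^sub>L 'a. R \<in> bounded_ops \<and>
    (\<forall>x. R (T x - \<mu> *\<^sub>C x) = x \<and> T (R x) - \<mu> *\<^sub>C R x = x))}"

definition spectral_radius :: "('a::complex_hilbert \<Rightarrow>\<^sub>L 'a) \<Rightarrow> real"
  where "spectral_radius T = (SUP \<mu>\<in>op_spectrum T. cmod \<mu>)"

definition rank_one :: "'a::complex_hilbert \<Rightarrow> 'a \<Rightarrow> ('a \<Rightarrow>\<^sub>L 'a)"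
  where "rank_one u v = Blinfun (\<lambda>h. cinner h v *\<^sub>C u)"

lemma rank_one_apply: "rank_one u v h = cinner h v *\<^sub>C u"
proof -
  have "bounded_linear (\<lambda>h. cinner h v *\<^sub>C u)"
  proof (rule bounded_linear_intro[where K = "norm v * norm u"])
    show "norm (cinner x v *\<^sub>C u) \<le> norm x * (norm v * norm u)" for x
      using mult_right_mono[OF cinner_Cauchy_Schwarz, of "norm u" x v]
      by (simp add: norm_scaleC mult.assoc)
  qed (simp_all add: cinner_add_left scaleC_add_left scaleR_scaleC cinner_scaleC_left
      scaleC_scaleC)
  then show ?thesis
    by (simp add: rank_one_def bounded_linear_Blinfun_apply)
qed

text \<open>The sequences \<open>d\<^sub>m\<close> and \<open>R\<^sub>m\<close> are meant for \<open>m \<ge> 1\<close>; the value at \<open>m = 0\<close> does not affect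
  the limit in \<open>Q_alg\<close>.\<close>

definition d_seq :: "('a::complex_hilbert \<Rightarrow>\<^sub>L 'a) \<Rightarrow> nat \<Rightarrow> real"
  where "d_seq T m = 1 / (1 / real m + spectral_radius T)"

definition R_seq :: "('a::complex_hilbert \<Rightarrow>\<^sub>L 'a) \<Rightarrow> nat \<Rightarrow> ('a \<Rightarrow>\<^sub>L 'a)"
  where "R_seq T m = op_sqrt
    (\<Sum>n. (d_seq T m) ^ (2 * n) *\<^sub>R (op_power (op_adjoint T) n o\<^sub>L op_power T n))"

definition Q_alg :: "('a::complex_hilbert \<Rightarrow>\<^sub>L 'a) \<Rightarrow> ('a \<Rightarrow>\<^sub>L 'a) set"
  where "Q_alg T = {S \<in> bounded_ops.
    (\<lambda>m. norm (R_seq T m o\<^sub>L S o\<^sub>L op_inverse (R_seq T m))) \<longlonglongrightarrow> 0}"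

definition orth_projection :: "'a::complex_hilbert set \<Rightarrow> ('a \<Rightarrow>\<^sub>L 'a)"
  where "orth_projection M =
    (THE P :: 'a \<Rightarrow>\<^sub>L 'a. P \<in> bounded_ops \<and> (\<forall>x. P x \<in> M \<and> (\<forall>y\<in>M. cinner (x - P x) y = 0)))"

end

theory Submission
  imports Defs
begin

text \<open>
Let \<open>T = u \<otimes> v\<close>, \<open>r = \<bar>\<langle>u, v\<rangle>\<bar>\<close>, and let \<open>P\<close> be the orthogonal projection onto the line of \<open>v\<close>. Since
\<open>T\<^sup>n\<^sup>+\<^sup>1 = \<langle>u, v\<rangle>\<^sup>n T\<close>, every \<open>T\<^sup>*\<^sup>n T\<^sup>n\<close> with \<open>n \<ge> 1\<close> is a multiple of \<open>v \<otimes> v = \<parallel>v\<parallel>\<^sup>2 P\<close>, and the series that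
defines \<open>R\<^sub>m\<^sup>2\<close> is geometric with ratio \<open>(d\<^sub>m r)\<^sup>2\<close>. The spectral radius of \<open>T\<close> is \<open>r\<close>
(\<open>spectral_radius_rank_one\<close>), so \<open>d\<^sub>m = 1 / (1/m + r)\<close>, the series converges, and it has the sum
\<open>I + (t\<^sub>m\<^sup>2 - 1) P\<close> with \<open>t\<^sub>m\<^sup>2 = 1 + \<parallel>u\<parallel>\<^sup>2 \<parallel>v\<parallel>\<^sup>2 / ((1/m + r)\<^sup>2 - r\<^sup>2)\<close>
(\<open>adjoint_power_series_rank_one\<close>). Its positive square root multiplies the line of \<open>v\<close> by \<open>t\<^sub>m\<close> and
fixes the orthogonal complement (\<open>op_sqrt_dilation\<close>, \<open>R_seq_rank_one\<close>). The denominator tends to 0,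
so \<open>t\<^sub>m\<close> tends to infinity when \<open>u\<close> and \<open>v\<close> are nonzero.

Write \<open>S\<close> as a block matrix for the decomposition into the ranges of \<open>P\<close> and \<open>I - P\<close>. Conjugation
by \<open>R\<^sub>m\<close> leaves the two diagonal blocks \<open>PSP\<close> and \<open>(I - P)S(I - P)\<close> alone, multiplies the block
\<open>PS(I - P)\<close> by \<open>t\<^sub>m\<close> and the block \<open>(I - P)SP\<close> by \<open>1/t\<^sub>m\<close>. As \<open>t\<^sub>m \<rightarrow> \<infinity>\<close>, the conjugates tend to 0 in
norm exactly when only the block \<open>(I - P)SP\<close> is present (\<open>conj_dilation_tendsto_zero_iff\<close>).

If \<open>v = 0\<close>, then \<open>P = 0\<close> and \<open>R\<^sub>m = I\<close>, and both sides of the equivalence say \<open>S = 0\<close>.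
\<close>

section \<open>Inner products and complex-linear operators\<close>

lemma cinner_diff_left: "cinner (x - y) (z :: 'a::complex_hilbert) = cinner x z - cinner y z"
  using cinner_add_left[of "x - y" y z] by simp

lemma cinner_diff_right: "cinner (x :: 'a::complex_hilbert) (y - z) = cinner x y - cinner x z"
  using cinner_add_right[of x "y - z" z] by simp

lemma cinner_scaleR_left: "cinner (a *\<^sub>R x) (y :: 'a::complex_hilbert) = of_real a * cinner x y"
  by (simp add: scaleR_scaleC cinner_scaleC_left)

lemma scaleR_scaleC_commute: "a *\<^sub>R c *\<^sub>C x = c *\<^sub>C a *\<^sub>R (x :: 'a::complex_hilbert)"
  by (simp add: scaleR_scaleC scaleC_scaleC mult.commute)

lemma cinner_eq_zero_iff: "cinner x x = 0 \<longleftrightarrow> x = (0 :: 'a::complex_hilbert)"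
  by (simp add: cinner_self)

lemma rank_one_bounded_ops: "rank_one u v \<in> bounded_ops"
  by (simp add: bounded_ops_def rank_one_apply cinner_scaleC_left scaleC_scaleC)

lemma op_adjoint_eqI:
  fixes A B :: "'a::complex_hilbert \<Rightarrow>\<^sub>L 'a"
  assumes "B \<in> bounded_ops" and "\<And>x y. cinner (A x) y = cinner x (B y)"
  shows "op_adjoint A = B"
  unfolding op_adjoint_def
proof (rule the_equality)
  fix C assume C: "C \<in> bounded_ops \<and> (\<forall>x y. cinner (A x) y = cinner x (C y))"
  show "C = B"
  proof (rule blinfun_eqI)
    fix y
    have "cinner z (C y) = cinner z (B y)" for z
      using C assms(2)[of z y] by simp
    then have "cinner (C y - B y) (C y - B y) = 0"
      by (simp add: cinner_diff_right)
    then show "C y = B y" by (simp add: cinner_eq_zero_iff)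
  qed
qed (use assms in simp)

lemma op_inverse_eqI:
  assumes "B \<in> bounded_ops" "B o\<^sub>L A = id_blinfun" "A o\<^sub>L B = id_blinfun"
  shows "op_inverse A = B"
  unfolding op_inverse_def
proof (rule the_equality)
  fix C assume C: "C \<in> bounded_ops \<and> C o\<^sub>L A = id_blinfun \<and> A o\<^sub>L C = id_blinfun"
  show "C = B"
  proof (rule blinfun_eqI)
    fix y
    have "C (A (B y)) = B y"
      using C by (metis blinfun_apply_blinfun_compose blinfun_apply_id_blinfun id_apply)
    moreover have "A (B y) = y"
      using assms(3) by (metis blinfun_apply_blinfun_compose blinfun_apply_id_blinfun id_apply)
    ultimately show "C y = B y" by simp
  qed
qed (use assms in simp)

section \<open>Operators with two eigenspaces\<close>

definition is_orth_projection :: "('a::complex_hilbert \<Rightarrow>\<^sub>L 'a) \<Rightarrow> bool"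
  where "is_orth_projection P \<longleftrightarrow> P \<in> bounded_ops \<and> (\<forall>x. P (P x) = P x) \<and>
    (\<forall>x y. cinner (P x) y = cinner x (P y))"

text \<open>For a projection \<open>P\<close> this is \<open>(I - P) + t P\<close>: the identity on the kernel, \<open>t\<close> on the range.\<close>

definition dilation :: "('a::complex_hilbert \<Rightarrow>\<^sub>L 'a) \<Rightarrow> real \<Rightarrow> ('a \<Rightarrow>\<^sub>L 'a)"
  where "dilation P t = id_blinfun + (t - 1) *\<^sub>R P"

lemma dilation_apply: "dilation P t x = (x - P x) + t *\<^sub>R P x"
  by (simp add: dilation_def blinfun.add_left blinfun.diff_left blinfun.scaleR_left scaleR_diff_left)

lemma dilation_bounded_ops: "P \<in> bounded_ops \<Longrightarrow> dilation P t \<in> bounded_ops"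
  by (auto simp: bounded_ops_def dilation_apply complex_vector.scale_right_diff_distrib
      scaleC_add_right scaleR_scaleC_commute)

lemma dilation_compose:
  assumes "is_orth_projection P"
  shows "dilation P s o\<^sub>L dilation P t = dilation P (s * t)"
  using assms
  by (intro blinfun_eqI)
    (simp add: is_orth_projection_def dilation_apply blinfun.add_right blinfun.diff_right
      blinfun.scaleR_right)

lemma dilation_one: "dilation P 1 = id_blinfun"
  by (simp add: dilation_def)

lemma op_inverse_dilation:
  assumes "is_orth_projection P" "t \<noteq> 0"
  shows "op_inverse (dilation P t) = dilation P (1 / t)"
  using assms
  by (intro op_inverse_eqI)
    (auto simp: dilation_compose dilation_one dilation_bounded_ops is_orth_projection_def)

lemma positive_op_dilation:
  assumes P: "is_orth_projection P" and "0 \<le> t"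
  shows "positive_op (dilation P t)"
proof -
  have "cinner (dilation P t x) x \<in> \<real>\<^sub>\<ge>\<^sub>0" for x
  proof -
    have a: "cinner (P x) x = cinner (P x) (P x)"
      using P unfolding is_orth_projection_def by metis
    have b: "cinner x (P x) = cinner (P x) (P x)"
      using P unfolding is_orth_projection_def by metis
    have "cinner (x - P x) x = cinner (x - P x) (x - P x)"
      by (simp add: cinner_diff_left cinner_diff_right a b)
    then have "cinner (dilation P t x) x = of_real ((norm (x - P x))\<^sup>2 + t * (norm (P x))\<^sup>2)"
      by (simp add: dilation_apply cinner_add_left cinner_scaleR_left a cinner_self)
    then show ?thesis
      using \<open>0 \<le> t\<close> by (simp only: nonneg_Reals_of_real_iff) simp
  qed
  then show ?thesis
    using P by (simp add: positive_op_def dilation_bounded_ops is_orth_projection_def)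
qed

text \<open>The positive square root of an operator keeps its eigenvectors: \<open>R\<^sup>2 - t\<^sup>2 = (R + t)(R - t)\<close>, so
  \<open>w = R x - t x\<close> satisfies \<open>R w = - t w\<close>, and a positive \<open>R\<close> has no negative eigenvalue. So a
  positive square root is determined on every eigenvector of its square.\<close>

lemma positive_op_sqrt_eigenvector:
  assumes R: "positive_op R" and "0 < t" and RR: "R (R x) = t\<^sup>2 *\<^sub>R x"
  shows "R x = t *\<^sub>R x"
proof -
  define w where "w = R x - t *\<^sub>R x"
  have "R w = - t *\<^sub>R w"
    by (simp add: w_def blinfun.diff_right blinfun.scaleR_right RR power2_eq_square algebra_simps)
  then have "cinner (R w) w = of_real (- t * (norm w)\<^sup>2)"
    by (simp only: cinner_scaleR_left cinner_self of_real_mult)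
  moreover have "cinner (R w) w \<in> \<real>\<^sub>\<ge>\<^sub>0"
    using R by (simp add: positive_op_def)
  ultimately have "0 \<le> - t * (norm w)\<^sup>2"
    by (simp only: nonneg_Reals_of_real_iff)
  then have "w = 0"
    using \<open>0 < t\<close> by (simp add: mult_le_0_iff)
  then show ?thesis by (simp add: w_def)
qed

lemma op_sqrt_dilation:
  assumes P: "is_orth_projection P" and "0 < t"
  shows "op_sqrt (dilation P (t\<^sup>2)) = dilation P t"
  unfolding op_sqrt_def
proof (rule the_equality)
  show "positive_op (dilation P t) \<and> dilation P t o\<^sub>L dilation P t = dilation P (t\<^sup>2)"
    using assms by (simp add: positive_op_dilation dilation_compose power2_eq_square)
next
  fix R assume "positive_op R \<and> R o\<^sub>L R = dilation P (t\<^sup>2)"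
  then have R: "positive_op R" and RR: "R (R x) = dilation P (t\<^sup>2) x" for x
    by (auto simp flip: blinfun_apply_blinfun_compose)
  have PP: "P (P x) = P x" for x
    using P by (simp add: is_orth_projection_def)
  show "R = dilation P t"
  proof (rule blinfun_eqI)
    fix x
    \<comment> \<open>\<open>P x\<close> and \<open>x - P x\<close> are eigenvectors of \<open>R\<^sup>2\<close> for \<open>t\<^sup>2\<close> and \<open>1\<close>.\<close>
    have "R (P x) = t *\<^sub>R P x"
      by (rule positive_op_sqrt_eigenvector[OF R \<open>0 < t\<close>])
        (simp add: RR dilation_apply PP)
    moreover have "R (x - P x) = 1 *\<^sub>R (x - P x)"
      by (rule positive_op_sqrt_eigenvector[OF R])
        (simp_all add: RR dilation_apply PP blinfun.diff_right)
    ultimately show "R x = dilation P t x"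
      by (simp add: dilation_apply blinfun.diff_right algebra_simps)
  qed
qed

text \<open>In the block decomposition given by \<open>P\<close>, the conjugates of \<open>S\<close> have blocks \<open>PSP\<close>, \<open>t PS(I - P)\<close>,
  \<open>(1/t) (I - P)SP\<close> and \<open>(I - P)S(I - P)\<close>. The first, second and fourth of these control the
  corresponding blocks of \<open>S\<close> as soon as \<open>t \<ge> 1\<close>; the third disappears in the limit if
  \<open>t \<rightarrow> \<infinity>\<close>. The alternative \<open>P = 0\<close>, where \<open>t\<close> may stay bounded, covers a degenerate line.\<close>

lemma conj_dilation_tendsto_zero_iff:
  assumes P: "is_orth_projection P"
    and t: "filterlim t at_top sequentially \<or> P = 0"
    and t1: "\<forall>\<^sub>F m in sequentially. 1 \<le> t m"
  shows "(\<lambda>m. norm (dilation P (t m) o\<^sub>L S o\<^sub>L dilation P (1 / t m))) \<longlonglongrightarrow> 0 \<longleftrightarrow>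
    S = (id_blinfun - P) o\<^sub>L S o\<^sub>L P" (is "?L \<longleftrightarrow> ?R")
proof -
  let ?Y = "\<lambda>m. dilation P (t m) o\<^sub>L S o\<^sub>L dilation P (1 / t m)"
  let ?N = "id_blinfun - P"
  have PP: "P (P x) = P x" for x
    using P by (simp add: is_orth_projection_def)
  show ?thesis
  proof
    assume L: ?L
    \<comment> \<open>The sum of the three blocks of \<open>S\<close> that have to vanish; it does not depend on \<open>m\<close>.\<close>
    define E where "E = S - (?N o\<^sub>L S o\<^sub>L P)"
    let ?B = "\<lambda>m. norm ?N * norm (?Y m) * norm ?N + norm P * norm (?Y m) * norm ?N
      + norm P * norm (?Y m) * norm P"
    have bound: "norm E \<le> ?B m" if "1 \<le> t m" for m
    proof -
      have E: "E = (?N o\<^sub>L ?Y m o\<^sub>L ?N) + (1 / t m) *\<^sub>R (P o\<^sub>L ?Y m o\<^sub>L ?N) + (P o\<^sub>L ?Y m o\<^sub>L P)"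
      proof (rule blinfun_eqI)
        fix x
        have "t m \<noteq> 0" using that by simp
        then show "E x = ((?N o\<^sub>L ?Y m o\<^sub>L ?N) + (1 / t m) *\<^sub>R (P o\<^sub>L ?Y m o\<^sub>L ?N)
            + (P o\<^sub>L ?Y m o\<^sub>L P)) x"
          by (simp add: E_def dilation_apply blinfun.add_left blinfun.diff_left blinfun.add_right
              blinfun.diff_right blinfun.scaleR_right blinfun.scaleR_left PP scaleR_diff_right)
      qed
      have tri: "norm (A o\<^sub>L ?Y m o\<^sub>L B) \<le> norm A * norm (?Y m) * norm B" for A B
        by (meson norm_blinfun_compose mult_right_mono norm_ge_zero order_trans)
      have sc: "norm ((1 / t m) *\<^sub>R (P o\<^sub>L ?Y m o\<^sub>L ?N)) \<le> norm (P o\<^sub>L ?Y m o\<^sub>L ?N)"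
        using that mult_left_le_one_le[of "norm (P o\<^sub>L ?Y m o\<^sub>L ?N)" "1 / t m"] by simp
      show ?thesis
        unfolding E using sc
        by (intro order_trans[OF norm_triangle_ineq] add_mono tri order_trans[OF sc tri])
    qed
    have "?B \<longlonglongrightarrow> norm ?N * 0 * norm ?N + norm P * 0 * norm ?N + norm P * 0 * norm P"
      by (intro tendsto_intros L)
    then have "norm E \<le> 0"
      using eventually_mono[OF t1 bound] by (intro tendsto_lowerbound[where f = ?B]) auto
    then show ?R by (simp add: E_def)
  next
    assume R: ?R
    have Sx: "S x = S (P x) - P (S (P x))" for x
      by (subst R) (simp add: blinfun.diff_left)
    have PS: "P (S x) = 0" for x
      by (subst Sx) (simp add: blinfun.diff_right PP)
    have SP: "S (P x) = S x" for x
      using Sx[of x] by (simp add: PS)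
    have Y: "?Y m = (1 / t m) *\<^sub>R S" for m
      by (rule blinfun_eqI)
        (simp add: dilation_apply blinfun.add_right blinfun.diff_right blinfun.scaleR_right
          blinfun.scaleR_left PS SP)
    show ?L
    proof (cases "P = 0")
      case True
      then have "S = 0" using SP by (intro blinfun_eqI) (simp add: blinfun.zero_left blinfun.zero_right)
      then show ?thesis by (simp add: Y)
    next
      case False
      then have "(\<lambda>m. inverse (t m)) \<longlonglongrightarrow> 0"
        using t by (intro tendsto_inverse_0_at_top) auto
      then have "(\<lambda>m. norm ((1 / t m) *\<^sub>R S)) \<longlonglongrightarrow> 0"
        by (intro tendsto_norm_zero)
          (simp add: inverse_eq_divide[symmetric] tendsto_scaleR[where b = S, THEN tendsto_eq_rhs])
      then show ?thesis by (simp only: Y)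
    qed
  qed
qed

section \<open>The projection onto a line\<close>

text \<open>For \<open>v = 0\<close> the quotient is \<open>0\<close>, so the formula gives the projection onto \<open>{0}\<close>, as it should.\<close>

definition line_proj :: "'a::complex_hilbert \<Rightarrow> ('a \<Rightarrow>\<^sub>L 'a)"
  where "line_proj v = (1 / (norm v)\<^sup>2) *\<^sub>R rank_one v v"

lemma rank_one_self: "rank_one v v = (norm v)\<^sup>2 *\<^sub>R line_proj v"
  by (cases "v = 0") (auto simp: line_proj_def intro: blinfun_eqI simp: rank_one_apply)

lemma line_proj_apply: "line_proj v x = (cinner x v / (norm v)\<^sup>2) *\<^sub>C v"
  by (simp add: line_proj_def blinfun.scaleR_left rank_one_apply scaleR_scaleC scaleC_scaleC)

lemma line_proj_self: "line_proj v v = v"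
  by (cases "v = 0") (simp_all add: line_proj_apply cinner_self scaleC_one)

lemma is_orth_projection_line_proj: "is_orth_projection (line_proj v)"
  unfolding is_orth_projection_def
proof (intro conjI allI)
  show b: "line_proj v \<in> bounded_ops"
    by (simp add: bounded_ops_def line_proj_apply cinner_scaleC_left scaleC_scaleC)
  fix x y
  show "line_proj v (line_proj v x) = line_proj v x"
    using b unfolding line_proj_apply[of v x] by (simp add: bounded_ops_def line_proj_self)
  show "cinner (line_proj v x) y = cinner x (line_proj v y)"
    by (simp add: line_proj_apply cinner_scaleC_left cinner_scaleC_right flip: cinner_commute)
qed

lemma orth_projection_cspan_singleton: "orth_projection (cspan {v}) = line_proj v"
  unfolding orth_projection_def
proof (rule the_equality)
  have "cinner (x - line_proj v x) v = 0" for x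
    using is_orth_projection_line_proj[of v]
    by (simp add: cinner_diff_left is_orth_projection_def line_proj_self)
  then show "line_proj v \<in> bounded_ops \<and> (\<forall>x. line_proj v x \<in> cspan {v} \<and>
      (\<forall>y\<in>cspan {v}. cinner (x - line_proj v x) y = 0))"
    using is_orth_projection_line_proj[of v]
    by (auto simp: is_orth_projection_def complex_vector.span_singleton cinner_scaleC_right line_proj_apply)
  fix Q assume Q: "Q \<in> bounded_ops \<and> (\<forall>x. Q x \<in> cspan {v} \<and> (\<forall>y\<in>cspan {v}. cinner (x - Q x) y = 0))"
  show "Q = line_proj v"
  proof (rule blinfun_eqI)
    fix x
    obtain c where c: "Q x = c *\<^sub>C v"
      using Q by (force simp: complex_vector.span_singleton)
    have "line_proj v (x - Q x) = 0"
      using Q by (simp add: line_proj_apply complex_vector.span_base)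
    moreover have "line_proj v (Q x) = Q x"
      using is_orth_projection_line_proj[of v] by (simp add: c is_orth_projection_def bounded_ops_def line_proj_self)
    ultimately show "Q x = line_proj v x"
      by (simp add: blinfun.diff_right)
  qed
qed

section \<open>Spectral radius and weighted power series of a rank-one operator\<close>

text \<open>The number \<open>\<langle>u, v\<rangle>\<close> is an eigenvalue with eigenvector \<open>u\<close>. The only other possible spectral value
  is \<open>0\<close>, which cannot raise the supremum, whether or not it belongs to the spectrum (it does not if
  the space is one-dimensional and \<open>v \<noteq> 0\<close>).\<close>

lemma spectral_radius_rank_one:
  assumes "u \<noteq> 0"
  shows "spectral_radius (rank_one u v) = cmod (cinner u v)"
  unfolding spectral_radius_def
proof (rule cSup_eq_maximum)
  show "cmod (cinner u v) \<in> cmod ` op_spectrum (rank_one u v)"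
  proof (rule imageI, unfold op_spectrum_def, rule CollectI, rule notI)
    assume "\<exists>R. R \<in> bounded_ops \<and> (\<forall>x. R (rank_one u v x - cinner u v *\<^sub>C x) = x \<and>
      rank_one u v (R x) - cinner u v *\<^sub>C R x = x)"
    then obtain R :: "'a \<Rightarrow>\<^sub>L 'a" where "R (rank_one u v u - cinner u v *\<^sub>C u) = u" by blast
    then show False
      using assms by (simp add: rank_one_apply blinfun.zero_right)
  qed
next
  fix r assume "r \<in> cmod ` op_spectrum (rank_one u v)"
  then obtain \<mu> where \<mu>: "\<mu> \<in> op_spectrum (rank_one u v)" and r: "r = cmod \<mu>" by auto
  have "\<mu> = 0 \<or> \<mu> = cinner u v"
  proof (rule ccontr)
    assume "\<not> (\<mu> = 0 \<or> \<mu> = cinner u v)"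
    then have n: "\<mu> \<noteq> 0" "cinner u v - \<mu> \<noteq> 0" by auto
    \<comment> \<open>The resolvent: taking the inner product of \<open>\<langle>x, v\<rangle> u - \<mu> x = y\<close> with \<open>v\<close> gives
      \<open>\<langle>x, v\<rangle> = \<langle>y, v\<rangle> / (\<langle>u, v\<rangle> - \<mu>)\<close>, and then the equation can be solved for \<open>x\<close>.\<close>
    define R where "R = rank_one ((1 / (\<mu> * (cinner u v - \<mu>))) *\<^sub>C u) v - Blinfun (\<lambda>x. (1 / \<mu>) *\<^sub>C x)"
    have bl: "bounded_linear (\<lambda>x::'a. (1 / \<mu>) *\<^sub>C x)"
      by (rule bounded_linear_intro[where K = "cmod (1 / \<mu>)"])
        (simp_all add: scaleC_add_right scaleR_scaleC_commute norm_scaleC mult.commute)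
    have R: "R x = (cinner x v / (\<mu> * (cinner u v - \<mu>))) *\<^sub>C u - (1 / \<mu>) *\<^sub>C x" for x
      by (simp add: R_def blinfun.diff_left rank_one_apply bounded_linear_Blinfun_apply[OF bl] scaleC_scaleC)
    have "R \<in> bounded_ops"
      by (simp add: bounded_ops_def R cinner_scaleC_left scaleC_scaleC
          complex_vector.scale_right_diff_distrib mult.commute)
    moreover have "R (rank_one u v x - \<mu> *\<^sub>C x) = x" for x
    proof -
      have "cinner (rank_one u v x - \<mu> *\<^sub>C x) v = cinner x v * (cinner u v - \<mu>)"
        by (simp add: rank_one_apply cinner_diff_left cinner_scaleC_left algebra_simps)
      then show ?thesis
        using n by (simp add: R)
          (simp add: rank_one_apply scaleC_scaleC complex_vector.scale_right_diff_distrib scaleC_one)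
    qed
    moreover have "rank_one u v (R x) - \<mu> *\<^sub>C R x = x" for x
    proof -
      have "cinner (R x) v = cinner x v / (cinner u v - \<mu>)"
        using n by (simp add: R cinner_diff_left cinner_scaleC_left divide_simps)
          (simp add: algebra_simps)
      then show ?thesis
        using n by (simp add: rank_one_apply)
          (simp add: R scaleC_scaleC complex_vector.scale_right_diff_distrib scaleC_one)
    qed
    ultimately show False using \<mu> unfolding op_spectrum_def by blast
  qed
  then show "r \<le> cmod (cinner u v)" by (auto simp: r)
qed


lemma op_power_Suc_rank_one:
  "op_power (rank_one u v) (Suc n) = rank_one (cinner u v ^ n *\<^sub>C u) v"
proof (induction n)
  case 0
  show ?case by (rule blinfun_eqI) (simp add: op_power_def scaleC_one)
next
  case (Suc n)
  have "op_power (rank_one u v) (Suc (Suc n)) = rank_one u v o\<^sub>L op_power (rank_one u v) (Suc n)"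
    by (simp add: op_power_def)
  then show ?case
    unfolding Suc by (intro blinfun_eqI)
      (simp add: rank_one_apply cinner_scaleC_left scaleC_scaleC mult.commute mult.left_commute)
qed

lemma op_adjoint_rank_one: "op_adjoint (rank_one u v) = rank_one v u"
proof (rule op_adjoint_eqI[OF rank_one_bounded_ops])
  show "cinner (rank_one u v x) y = cinner x (rank_one v u y)" for x y
    by (simp add: rank_one_apply cinner_scaleC_left cinner_scaleC_right)
      (metis cinner_commute mult.commute)
qed

lemma adjoint_power_compose_rank_one:
  "op_power (op_adjoint (rank_one u v)) (Suc n) o\<^sub>L op_power (rank_one u v) (Suc n)
    = ((cmod (cinner u v))\<^sup>2 ^ n * (norm u)\<^sup>2) *\<^sub>R rank_one v v"
proof -
  have "cinner v u ^ n * cinner u v ^ n = (cinner u v * cnj (cinner u v)) ^ n"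
    unfolding cinner_commute[of v u] power_mult_distrib by (rule mult.commute)
  also have "\<dots> = complex_of_real ((cmod (cinner u v))\<^sup>2 ^ n)"
    unfolding complex_norm_square[symmetric] by (rule of_real_power[symmetric])
  finally have c: "cinner v u ^ n * cinner u v ^ n = complex_of_real ((cmod (cinner u v))\<^sup>2 ^ n)" .
  show ?thesis
  proof (rule blinfun_eqI)
    fix x
    have "cinner x v * cinner u v ^ n * cinner u u * cinner v u ^ n
        = (cinner v u ^ n * cinner u v ^ n) * cinner u u * cinner x v"
      by (simp only: mult_ac)
    then have k: "cinner x v * cinner u v ^ n * cinner u u * cinner v u ^ n
        = complex_of_real ((cmod (cinner u v))\<^sup>2 ^ n * (norm u)\<^sup>2) * cinner x v"
      by (simp only: c cinner_self of_real_mult)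
    have "op_power (op_adjoint (rank_one u v)) (Suc n) (op_power (rank_one u v) (Suc n) x)
        = (cinner x v * cinner u v ^ n * cinner u u * cinner v u ^ n) *\<^sub>C v"
      by (simp only: op_adjoint_rank_one op_power_Suc_rank_one rank_one_apply cinner_scaleC_left
          scaleC_scaleC mult_ac)
    then show "blinfun_apply (op_power (op_adjoint (rank_one u v)) (Suc n) o\<^sub>L op_power (rank_one u v) (Suc n)) x
        = blinfun_apply (((cmod (cinner u v))\<^sup>2 ^ n * (norm u)\<^sup>2) *\<^sub>R rank_one v v) x"
      by (simp only: k blinfun_apply_blinfun_compose blinfun.scaleR_left rank_one_apply scaleR_scaleC scaleC_scaleC)
  qed
qed

lemma adjoint_power_series_rank_one:
  fixes u v :: "'a::complex_hilbert"
  assumes d: "\<bar>d * cmod (cinner u v)\<bar> < 1"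
  shows "(\<Sum>n. d ^ (2 * n) *\<^sub>R (op_power (op_adjoint (rank_one u v)) n o\<^sub>L op_power (rank_one u v) n))
    = id_blinfun + (d\<^sup>2 * (norm u)\<^sup>2 / (1 - (d * cmod (cinner u v))\<^sup>2)) *\<^sub>R rank_one v v"
    (is "suminf ?f = _ + ?c *\<^sub>R _")
proof -
  let ?q = "(d * cmod (cinner u v))\<^sup>2"
  have "norm ?q < 1"
    using d by (simp add: abs_square_less_1)
  then have "(\<lambda>n. ?q ^ n) sums (1 / (1 - ?q))"
    by (rule geometric_sums)
  then have "(\<lambda>n. (d\<^sup>2 * (norm u)\<^sup>2) * ?q ^ n) sums (d\<^sup>2 * (norm u)\<^sup>2 * (1 / (1 - ?q)))"
    by (rule sums_mult)
  then have "(\<lambda>n. (d\<^sup>2 * (norm u)\<^sup>2 * ?q ^ n) *\<^sub>R rank_one v v) sums (?c *\<^sub>R rank_one v v)"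
    using sums_scaleR_left by fastforce
  moreover have "?f (Suc n) = (d\<^sup>2 * (norm u)\<^sup>2 * ?q ^ n) *\<^sub>R rank_one v v" for n
  proof -
    have "d ^ (2 * Suc n) = d\<^sup>2 * (d\<^sup>2) ^ n"
      by (simp only: power_mult power_Suc)
    then show ?thesis
      unfolding adjoint_power_compose_rank_one
      by (simp only: scaleR_scaleR power_mult_distrib mult_ac)
  qed
  ultimately have "(\<lambda>n. ?f (Suc n)) sums (?c *\<^sub>R rank_one v v)"
    by simp
  then have "?f sums (?c *\<^sub>R rank_one v v + ?f 0)"
    by (rule sums_Suc)
  moreover have "?f 0 = id_blinfun"
    by (rule blinfun_eqI) (simp add: op_power_def)
  ultimately show ?thesis
    by (simp add: sums_iff add.commute)
qed

text \<open>The eigenvalue of \<open>R\<^sub>m\<close> on the line of \<open>v\<close>. The denominator is \<open>1/d\<^sub>m\<^sup>2 - r\<^sup>2\<close> with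
  \<open>r = \<bar>\<langle>u, v\<rangle>\<bar>\<close>, which comes from dividing \<open>d\<^sub>m\<^sup>2 / (1 - (d\<^sub>m r)\<^sup>2)\<close> through by \<open>d\<^sub>m\<^sup>2\<close>.\<close>

definition stretch_factor :: "'a::complex_hilbert \<Rightarrow> 'a \<Rightarrow> nat \<Rightarrow> real"
  where "stretch_factor u v m =
    sqrt (1 + (norm u * norm v)\<^sup>2 / ((1 / real m + cmod (cinner u v))\<^sup>2 - (cmod (cinner u v))\<^sup>2))"

lemma stretch_factor_denom_pos:
  assumes "0 < m" "0 \<le> r"
  shows "r\<^sup>2 < (1 / real m + r)\<^sup>2"
  using assms by (intro power_strict_mono) auto

lemma stretch_factor_ge_one:
  assumes "0 < m"
  shows "1 \<le> stretch_factor u v m"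
  using stretch_factor_denom_pos[OF assms, of "cmod (cinner u v)"]
  by (simp add: stretch_factor_def)

lemma R_seq_rank_one:
  assumes "u \<noteq> 0" "0 < m"
  shows "R_seq (rank_one u v) m = dilation (line_proj v) (stretch_factor u v m)"
proof -
  define r where "r = cmod (cinner u v)"
  define d where "d = d_seq (rank_one u v) m"
  have d: "d = 1 / (1 / real m + r)"
    by (simp add: d_def d_seq_def spectral_radius_rank_one assms r_def)
  have r: "0 \<le> r" by (simp add: r_def)
  have p: "0 < 1 / real m + r" using r assms by (simp add: add_pos_nonneg)
  have dr: "\<bar>d * r\<bar> < 1"
    using r p assms by (simp add: d abs_mult)
  define g where "g = (1 / real m + r)\<^sup>2 - r\<^sup>2"
  have g: "0 < g" using stretch_factor_denom_pos[OF assms(2) r] by (simp add: g_def)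
  have t2: "(stretch_factor u v m)\<^sup>2 = 1 + (norm u * norm v)\<^sup>2 / g"
    using g unfolding stretch_factor_def r_def[symmetric] g_def[symmetric] by simp
  have "1 - (d * r)\<^sup>2 = d\<^sup>2 * g"
    using p by (simp add: d g_def power_divide right_diff_distrib)
  moreover have "d\<^sup>2 \<noteq> 0" using p by (simp add: d)
  ultimately have c: "d\<^sup>2 * (norm u)\<^sup>2 / (1 - (d * r)\<^sup>2) = (norm u)\<^sup>2 / g"
    by simp
  have "R_seq (rank_one u v) m = op_sqrt (id_blinfun + ((norm u)\<^sup>2 / g) *\<^sub>R rank_one v v)"
    unfolding R_seq_def d_def[symmetric]
    using adjoint_power_series_rank_one[of d u v] dr c by (simp add: r_def)
  also have "id_blinfun + ((norm u)\<^sup>2 / g) *\<^sub>R rank_one v v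
      = dilation (line_proj v) ((stretch_factor u v m)\<^sup>2)"
    unfolding rank_one_self t2 by (simp add: dilation_def power_mult_distrib)
  also have "op_sqrt \<dots> = dilation (line_proj v) (stretch_factor u v m)"
    using stretch_factor_ge_one[OF assms(2), of u v]
    by (intro op_sqrt_dilation is_orth_projection_line_proj) simp
  finally show ?thesis .
qed

lemma filterlim_stretch_factor:
  assumes "u \<noteq> 0" "v \<noteq> 0"
  shows "filterlim (stretch_factor u v) at_top sequentially"
proof -
  define r where "r = cmod (cinner u v)"
  have "(\<lambda>m. (1 / real m + r)\<^sup>2 - r\<^sup>2) \<longlonglongrightarrow> (0 + r)\<^sup>2 - r\<^sup>2"
    by (intro tendsto_intros lim_1_over_n)
  moreover have "\<forall>\<^sub>F m in sequentially. (1 / real m + r)\<^sup>2 - r\<^sup>2 > 0"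
    using eventually_gt_at_top[of 0]
    by eventually_elim (simp add: stretch_factor_denom_pos r_def)
  ultimately have "filterlim (\<lambda>m. (norm u * norm v)\<^sup>2 / ((1 / real m + r)\<^sup>2 - r\<^sup>2)) at_top sequentially"
    using assms by (intro LIM_at_top_divide[OF tendsto_const]) auto
  then have "filterlim (\<lambda>m. sqrt (1 + (norm u * norm v)\<^sup>2 / ((1 / real m + r)\<^sup>2 - r\<^sup>2))) at_top sequentially"
    by (intro filterlim_compose[OF sqrt_at_top] filterlim_tendsto_add_at_top[OF tendsto_const])
  then show ?thesis by (simp add: stretch_factor_def[abs_def] r_def)
qed

theorem theorem2p18:
  fixes S :: "'a::complex_hilbert \<Rightarrow>\<^sub>L 'a" and u v :: 'a
  assumes "S \<in> bounded_ops"
    and "u \<noteq> 0"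
  shows "S \<in> Q_alg (rank_one u v) \<longleftrightarrow>
    (let P = orth_projection (cspan {v}) in S = (id_blinfun - P) o\<^sub>L S o\<^sub>L P)"
proof -
  let ?P = "line_proj v" and ?t = "stretch_factor u v"
  have t1: "\<forall>\<^sub>F m in sequentially. 1 \<le> ?t m"
    using eventually_gt_at_top[of 0] by eventually_elim (rule stretch_factor_ge_one)
  have "\<forall>\<^sub>F m in sequentially.
    norm (R_seq (rank_one u v) m o\<^sub>L S o\<^sub>L op_inverse (R_seq (rank_one u v) m)) =
    norm (dilation ?P (?t m) o\<^sub>L S o\<^sub>L dilation ?P (1 / ?t m))"
    using eventually_gt_at_top[of 0] t1
    by eventually_elim
      (simp add: R_seq_rank_one assms(2) op_inverse_dilation is_orth_projection_line_proj)
  then have "S \<in> Q_alg (rank_one u v) \<longleftrightarrow>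
      (\<lambda>m. norm (dilation ?P (?t m) o\<^sub>L S o\<^sub>L dilation ?P (1 / ?t m))) \<longlonglongrightarrow> 0"
    using assms(1) by (simp add: Q_alg_def tendsto_cong)
  also have "\<dots> \<longleftrightarrow> S = (id_blinfun - ?P) o\<^sub>L S o\<^sub>L ?P"
  proof (rule conj_dilation_tendsto_zero_iff[OF is_orth_projection_line_proj _ t1])
    show "filterlim ?t at_top sequentially \<or> ?P = 0"
    proof (cases "v = 0")
      case True
      then show ?thesis by (simp add: line_proj_def)
    next
      case False
      then show ?thesis using filterlim_stretch_factor assms(2) by blast
    qed
  qed
  finally show ?thesis
    by (simp only: orth_projection_cspan_singleton Let_def)
qed

end
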